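(* Let $f:\mathbb{R}^d\to\mathbb{R}$ be a $C^2$ function whose Hessian $\nabla^2f(\mathbf{x}^* )$ is invertible at every strict saddle point $\mathbf{x}^*$ of $f$. Let $\{\alpha_k\}_{k\in\mathbb{N}}$ be a sequence of positive real numbers of order $\Omega(1/k)$ that converges to zero, and let $$\mathbf{x}_{k+1}=g(k,\mathbf{x}_k):=\operatorname*{arg\,min}_{\mathbf{z}}\ f(\mathbf{z})+\frac{1}{2\alpha_k}\|\mathbf{x}_k-\mathbf{z}\|^2$$ be the proximal point algorithm. Then the stable set of strict saddle points, $W^s(\mathcal{X}^* )=\{\mathbf{x}_0\in\mathbb{R}^d:\lim_{k\to\infty}\mathbf{x}_k\in\mathcal{X}^*\}$, has Lebesgue measure zero.
   Context: $\mathbb{N}$ denotes the nonnegative integers and $\|\cdot\|$ the Euclidean norm. A positive sequence $\alpha_k$ is of order $\Omega(1/k)$ if there are $c>0$ and $k_0$ with $\alpha_k\ge c/k$ for all $k\ge k_0$. It is implicit that the minimizer defining $g(k,\cdot)$ exists and is unique, so that $g(k,\cdot):\mathbb{R}^d\to\mathbb{R}^d$ is a map. A critical point of $f$ is a point $\mathbf{x}^*$ with $\nabla f(\mathbf{x}^* )=0$; it is a strict saddle if $\lambda_{\min}(\nabla^2f(\mathbf{x}^* ))<0$. $\mathcal{X}^*$ is the set of strict saddle points of $f$. *)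

theory Defs
  imports "HOL-Analysis.Analysis" "HOL-Library.Landau_Symbols"
begin

definition gradient :: "(real^'n \<Rightarrow> real) \<Rightarrow> real^'n \<Rightarrow> real^'n" where
  "gradient f x = (THE D. GDERIV f x :> D)"

definition hessian :: "(real^'n \<Rightarrow> real) \<Rightarrow> real^'n \<Rightarrow> real^'n^'n" where
  "hessian f x = jacobian (gradient f) (at x)"

definition C2 :: "(real^'n \<Rightarrow> real) \<Rightarrow> bool" where
  "C2 f \<longleftrightarrow> (\<forall>x. f differentiable at x) \<and> (\<forall>x. gradient f differentiable at x) \<and>
     continuous_on UNIV (hessian f)"

definition eigenvalues :: "real^'n^'n \<Rightarrow> real set" where
  "eigenvalues A = {c. \<exists>v. v \<noteq> 0 \<and> A *v v = c *\<^sub>R v}"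

text \<open>Meant for symmetric \<open>A\<close> (such as the Hessian of a \<open>C\<^sup>2\<close> function), where the set of
  real eigenvalues is finite and nonempty, so that \<^const>\<open>Min\<close> is a genuine minimum.\<close>

definition lambda_min :: "real^'n^'n \<Rightarrow> real" where
  "lambda_min A = Min (eigenvalues A)"

definition strict_saddles :: "(real^'n \<Rightarrow> real) \<Rightarrow> (real^'n) set" where
  "strict_saddles f = {x. gradient f x = 0 \<and> lambda_min (hessian f x) < 0}"

definition prox_objective :: "(real^'n \<Rightarrow> real) \<Rightarrow> real \<Rightarrow> real^'n \<Rightarrow> real^'n \<Rightarrow> real" where
  "prox_objective f a x z = f z + 1 / (2 * a) * (norm (x - z))\<^sup>2"

definition prox_well_defined :: "(real^'n \<Rightarrow> real) \<Rightarrow> (nat \<Rightarrow> real) \<Rightarrow> bool" where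
  "prox_well_defined f \<alpha> \<longleftrightarrow>
     (\<forall>k x. \<exists>!z. is_arg_min (prox_objective f (\<alpha> k) x) (\<lambda>_. True) z)"

text \<open>\<^const>\<open>arg_min\<close> is a choice operator; under \<^const>\<open>prox_well_defined\<close> it picks the unique
  minimizer, and only then is the following map meaningful.\<close>

definition prox_map :: "(real^'n \<Rightarrow> real) \<Rightarrow> (nat \<Rightarrow> real) \<Rightarrow> nat \<Rightarrow> real^'n \<Rightarrow> real^'n" where
  "prox_map f \<alpha> k x = arg_min (prox_objective f (\<alpha> k) x) (\<lambda>_. True)"

primrec prox_seq :: "(real^'n \<Rightarrow> real) \<Rightarrow> (nat \<Rightarrow> real) \<Rightarrow> real^'n \<Rightarrow> nat \<Rightarrow> real^'n" where
  "prox_seq f \<alpha> x0 0 = x0"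
| "prox_seq f \<alpha> x0 (Suc k) = prox_map f \<alpha> k (prox_seq f \<alpha> x0 k)"

definition stable_set :: "(real^'n \<Rightarrow> real) \<Rightarrow> (nat \<Rightarrow> real) \<Rightarrow> (real^'n) set \<Rightarrow> (real^'n) set" where
  "stable_set f \<alpha> X = {x0. \<exists>p\<in>X. prox_seq f \<alpha> x0 \<longlonglongrightarrow> p}"

end

theory Submission
  imports Defs
begin

text \<open>Run backwards, a proximal step is the explicit map \<open>x k = x (k + 1) + \<alpha> k *\<^sub>R \<nabla>f (x (k + 1))\<close>.
  Consider two trajectories that stay near a saddle \<open>p\<close> with Hessian \<open>H\<close>, and let \<open>d k\<close> be their
  difference. Since \<open>H\<close> is symmetric and invertible, \<open>d k \<bullet> H (d k)\<close> decreases by at least a multiple of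
  \<open>\<alpha> k * (norm (d (k + 1)))\<^sup>2\<close> at each step; were it ever negative, it would be unbounded because
  \<open>\<Sum>\<alpha> k = \<infinity>\<close>. So the points whose trajectory stays near \<open>p\<close> differ only by vectors on which \<open>H\<close> is
  nonnegative, which makes them a null set, as \<open>H\<close> has a negative direction. The starting points are
  the images of such null sets under compositions of the differentiable backward maps, and by
  Lindelof's theorem countably many neighbourhoods of saddles suffice. This replaces the stable manifold
  theorem and needs no regularity of the proximal map.\<close>

section \<open>Symmetry of second derivatives\<close>

text \<open>The mean value theorem is applied twice: along \<open>v\<close> to the difference of
  \<open>f\<close> on two parallel segments, then along \<open>u\<close> to \<open>g\<close> paired
  with \<open>v\<close>. The left side is symmetric in \<open>u\<close> and \<open>v\<close>, the
  right side visibly is not.\<close>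

lemma second_difference_mean_value:
  fixes f :: "'a::real_inner \<Rightarrow> real" and g :: "'a \<Rightarrow> 'a"
  assumes f: "\<And>x. GDERIV f x :> g x" and g: "\<And>x. (g has_derivative H x) (at x)" and "t > 0"
  obtains a b where "0 < a" "a < t" "0 < b" "b < t"
    "f (x + t *\<^sub>R u + t *\<^sub>R v) - f (x + t *\<^sub>R u) - f (x + t *\<^sub>R v) + f x
       = t\<^sup>2 * (H (x + a *\<^sub>R u + b *\<^sub>R v) u \<bullet> v)"
proof -
  have der: "((\<lambda>s. f (y + s *\<^sub>R v)) has_real_derivative g (y + s *\<^sub>R v) \<bullet> v) (at s)" for y s
  proof -
    have "((\<lambda>s. f (y + s *\<^sub>R v)) has_derivative (\<lambda>h. (h *\<^sub>R v) \<bullet> g (y + s *\<^sub>R v))) (at s)"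
      by (rule has_derivative_compose[of "\<lambda>s. y + s *\<^sub>R v", OF _ f[unfolded gderiv_def]])
         (auto intro!: derivative_eq_intros)
    then show ?thesis
      by (simp add: has_field_derivative_def inner_commute mult.commute[of _ "_ \<bullet> _"] mult_commute_abs)
  qed
  have "\<exists>b>0. b < t \<and> (f (x + t *\<^sub>R u + t *\<^sub>R v) - f (x + t *\<^sub>R v))
        - (f (x + t *\<^sub>R u + 0 *\<^sub>R v) - f (x + 0 *\<^sub>R v))
        = (t - 0) * (g (x + t *\<^sub>R u + b *\<^sub>R v) \<bullet> v - g (x + b *\<^sub>R v) \<bullet> v)"
    by (rule MVT2[OF \<open>t > 0\<close>]) (intro DERIV_diff der)
  then obtain b where b: "0 < b" "b < t" and eq1: "f (x + t *\<^sub>R u + t *\<^sub>R v) - f (x + t *\<^sub>R v)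
        - f (x + t *\<^sub>R u) + f x = t * (g (x + t *\<^sub>R u + b *\<^sub>R v) \<bullet> v - g (x + b *\<^sub>R v) \<bullet> v)"
    by auto
  have der': "((\<lambda>r. g (x + r *\<^sub>R u + b *\<^sub>R v) \<bullet> v) has_real_derivative
          H (x + r *\<^sub>R u + b *\<^sub>R v) u \<bullet> v) (at r)" for r
  proof -
    have "((\<lambda>r. g (x + r *\<^sub>R u + b *\<^sub>R v)) has_derivative
            (\<lambda>h. H (x + r *\<^sub>R u + b *\<^sub>R v) (h *\<^sub>R u))) (at r)"
      by (rule has_derivative_compose[of "\<lambda>r. x + r *\<^sub>R u + b *\<^sub>R v", OF _ g])
         (auto intro!: derivative_eq_intros)
    then have "((\<lambda>r. g (x + r *\<^sub>R u + b *\<^sub>R v) \<bullet> v) has_derivative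
            (\<lambda>h. H (x + r *\<^sub>R u + b *\<^sub>R v) (h *\<^sub>R u) \<bullet> v)) (at r)"
      by (rule has_derivative_inner_left)
    then show ?thesis
      by (simp add: has_field_derivative_def linear_scale[OF has_derivative_linear[OF g]]
          mult_commute_abs)
  qed
  have "\<exists>a>0. a < t \<and> g (x + t *\<^sub>R u + b *\<^sub>R v) \<bullet> v - g (x + 0 *\<^sub>R u + b *\<^sub>R v) \<bullet> v
      = (t - 0) * (H (x + a *\<^sub>R u + b *\<^sub>R v) u \<bullet> v)"
    by (rule MVT2[OF \<open>t > 0\<close>]) (rule der')
  then obtain a where "0 < a" "a < t"
    "g (x + t *\<^sub>R u + b *\<^sub>R v) \<bullet> v - g (x + b *\<^sub>R v) \<bullet> v = t * (H (x + a *\<^sub>R u + b *\<^sub>R v) u \<bullet> v)"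
    by auto
  with b eq1 show thesis
    by (intro that[of a b]) (simp_all add: power2_eq_square algebra_simps)
qed

text \<open>Schwarz's argument: the second difference divided by the square of the step tends both
  to \<open>H x u \<bullet> v\<close> and, with the roles exchanged, to
  \<open>H x v \<bullet> u\<close>.\<close>

lemma symmetric_second_derivative:
  fixes f :: "'a::real_inner \<Rightarrow> real" and g :: "'a \<Rightarrow> 'a"
  assumes f: "\<And>x. GDERIV f x :> g x" and g: "\<And>x. (g has_derivative H x) (at x)"
    and cont: "\<And>u. isCont (\<lambda>y. H y u) x"
  shows "H x u \<bullet> v = u \<bullet> H x v"
proof -
  define t where "t n = 1 / real (Suc n)" for n
  have t: "t n > 0" for n by (simp add: t_def)
  have t0: "t \<longlonglongrightarrow> 0"
    unfolding t_def by (rule LIMSEQ_Suc[OF lim_1_over_n])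
  define \<Delta> where "\<Delta> n = f (x + t n *\<^sub>R u + t n *\<^sub>R v) - f (x + t n *\<^sub>R u) - f (x + t n *\<^sub>R v) + f x" for n
  \<comment> \<open>Directions and sequence are left general so that the same limit can be taken for
    \<open>(u, v)\<close> and for \<open>(v, u)\<close>, both times with the sequence
    \<Delta>.\<close>
  have lim: "(\<lambda>n. \<Delta>' n / (t n)\<^sup>2) \<longlonglongrightarrow> H x u' \<bullet> v'"
    if eq: "\<And>n. \<Delta>' n = f (x + t n *\<^sub>R u' + t n *\<^sub>R v') - f (x + t n *\<^sub>R u') - f (x + t n *\<^sub>R v') + f x"
    for u' v' \<Delta>'
  proof -
    have "\<exists>a b. 0 < a \<and> a < t n \<and> 0 < b \<and> b < t n \<and>
        \<Delta>' n = (t n)\<^sup>2 * (H (x + a *\<^sub>R u' + b *\<^sub>R v') u' \<bullet> v')" for n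
      by (rule second_difference_mean_value[OF f g t[of n], of x u' v']) (unfold eq, blast)
    then obtain a b where ab: "\<And>n. 0 < a n \<and> a n < t n \<and> 0 < b n \<and> b n < t n \<and>
        \<Delta>' n = (t n)\<^sup>2 * (H (x + a n *\<^sub>R u' + b n *\<^sub>R v') u' \<bullet> v')"
      by metis
    have "a \<longlonglongrightarrow> 0" "b \<longlonglongrightarrow> 0"
      by (rule tendsto_sandwich[OF _ _ tendsto_const t0];
          use ab in \<open>auto intro!: always_eventually less_imp_le\<close>)+
    then have "(\<lambda>n. x + a n *\<^sub>R u' + b n *\<^sub>R v') \<longlonglongrightarrow> x + 0 *\<^sub>R u' + 0 *\<^sub>R v'"
      by (intro tendsto_intros)
    then have "(\<lambda>n. H (x + a n *\<^sub>R u' + b n *\<^sub>R v') u') \<longlonglongrightarrow> H x u'"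
      using isCont_tendsto_compose[OF cont] by simp
    then have "(\<lambda>n. H (x + a n *\<^sub>R u' + b n *\<^sub>R v') u' \<bullet> v') \<longlonglongrightarrow> H x u' \<bullet> v'"
      by (intro tendsto_intros)
    moreover have "H (x + a n *\<^sub>R u' + b n *\<^sub>R v') u' \<bullet> v' = \<Delta>' n / (t n)\<^sup>2" for n
      using ab[of n] by auto
    ultimately show ?thesis by simp
  qed
  have "(\<lambda>n. \<Delta> n / (t n)\<^sup>2) \<longlonglongrightarrow> H x u \<bullet> v"
    by (rule lim) (simp add: \<Delta>_def)
  moreover have "(\<lambda>n. \<Delta> n / (t n)\<^sup>2) \<longlonglongrightarrow> H x v \<bullet> u"
    by (rule lim) (simp add: \<Delta>_def algebra_simps)
  ultimately show ?thesis
    using LIMSEQ_unique by (metis inner_commute)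
qed

section \<open>The least eigenvalue of a symmetric matrix\<close>

text \<open>Eigenvectors of distinct eigenvalues are orthogonal, so one eigenvector per eigenvalue
  gives an independent family. Finiteness and nonemptiness together make \<open>Min\<close> in
  \<open>lambda_min\<close> a true minimum.\<close>

lemma finite_eigenvalues_symmetric:
  fixes A :: "real^'n^'n"
  assumes sym: "\<And>u v. (A *v u) \<bullet> v = u \<bullet> (A *v v)"
  shows "finite (eigenvalues A)"
proof -
  have "\<exists>v. \<forall>c \<in> eigenvalues A. v c \<noteq> 0 \<and> A *v (v c) = c *\<^sub>R (v c)"
    by (intro bchoice) (auto simp: eigenvalues_def)
  then obtain v where v: "\<And>c. c \<in> eigenvalues A \<Longrightarrow> v c \<noteq> 0 \<and> A *v (v c) = c *\<^sub>R (v c)"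
    by blast
  have orth: "v c \<bullet> v c' = 0" if "c \<in> eigenvalues A" "c' \<in> eigenvalues A" "c \<noteq> c'" for c c'
    using sym[of "v c" "v c'"] v that by simp
  have "inj_on v (eigenvalues A)"
    using orth v by (metis inj_onI inner_eq_zero_iff)
  moreover have "pairwise orthogonal (v ` eigenvalues A)"
    using orth by (auto simp: pairwise_def orthogonal_def)
  then have "independent (v ` eigenvalues A)"
    using v by (intro pairwise_orthogonal_independent) auto
  then have "finite (v ` eigenvalues A)"
    using independent_bound by blast
  ultimately show ?thesis
    by (rule finite_imageD[rotated])
qed

text \<open>Otherwise a small move from \<open>x\<close> along \<open>- H x\<close> would make the
  form negative, its first-order change being \<open>- 2 * t * (y \<bullet> y)\<close> with
  \<open>y = H x\<close>.\<close>

lemma symmetric_psd_kernel: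
  fixes H :: "'a::real_inner \<Rightarrow> 'a"
  assumes lin: "linear H" and sym: "\<And>u v. H u \<bullet> v = u \<bullet> H v"
    and psd: "\<And>u. u \<bullet> H u \<ge> 0" and "x \<bullet> H x = 0"
  shows "H x = 0"
proof (rule ccontr)
  assume "H x \<noteq> 0"
  define y where "y = H x"
  define c where "c = y \<bullet> H y"
  have yy: "y \<bullet> y > 0" using \<open>H x \<noteq> 0\<close> by (simp add: y_def)
  have c: "c \<ge> 0" by (simp add: c_def psd)
  have form: "(x - t *\<^sub>R y) \<bullet> H (x - t *\<^sub>R y) = t\<^sup>2 * c - 2 * t * (y \<bullet> y)" for t
    using sym[of x y] \<open>x \<bullet> H x = 0\<close>
    by (simp add: linear_diff[OF lin] linear_scale[OF lin] algebra_simps inner_diff_left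
        inner_diff_right y_def[symmetric] c_def power2_eq_square)
  \<comment> \<open>Small enough for the linear term to beat the quadratic one; the
    \<open>+ 1\<close> covers \<open>c = 0\<close>.\<close>
  define t where "t = (y \<bullet> y) / (c + 1)"
  have t: "t > 0" "t * c \<le> y \<bullet> y"
    using yy c by (simp_all add: t_def field_simps)
  have "t * (t * c) \<le> t * (y \<bullet> y)"
    using t by (intro mult_left_mono) auto
  moreover have "t * (y \<bullet> y) > 0" using t yy by simp
  ultimately have "(x - t *\<^sub>R y) \<bullet> H (x - t *\<^sub>R y) < 0"
    unfolding form by (simp add: power2_eq_square algebra_simps)
  with psd[of "x - t *\<^sub>R y"] show False by simp
qed

text \<open>A minimizer \<open>x\<close> of the Rayleigh quotient is an eigenvector: with
  \<open>l\<close> the minimum, the form of \<open>A - l I\<close> is nonnegative and vanishes at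
  \<open>x\<close>, so \<open>x\<close> lies in its kernel.\<close>

lemma eigenvalues_symmetric_nonempty:
  fixes A :: "real^'n^'n"
  assumes sym: "\<And>u v. (A *v u) \<bullet> v = u \<bullet> (A *v v)"
  shows "eigenvalues A \<noteq> {}"
proof -
  let ?S = "sphere 0 1 :: (real^'n) set"
  have "continuous_on ?S (\<lambda>u. u \<bullet> (A *v u))"
    by (intro continuous_intros linear_continuous_on matrix_vector_mul_bounded_linear)
  moreover have "?S \<noteq> {}" by simp
  ultimately obtain x where x: "x \<in> ?S" "\<And>u. u \<in> ?S \<Longrightarrow> x \<bullet> (A *v x) \<le> u \<bullet> (A *v u)"
    using continuous_attains_inf[OF compact_sphere, of "0 :: real^'n" 1 "\<lambda>u. u \<bullet> (A *v u)"] by blast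
  define l where "l = x \<bullet> (A *v x)"
  have xx: "x \<bullet> x = 1" using x(1) by (simp add: dot_square_norm)
  have psd: "u \<bullet> (A *v u - l *\<^sub>R u) \<ge> 0" for u
  proof (cases "u = 0")
    case False
    have "l \<le> (u /\<^sub>R norm u) \<bullet> (A *v (u /\<^sub>R norm u))"
      unfolding l_def using False by (intro x(2)) simp
    also have "\<dots> = (u \<bullet> (A *v u)) / (norm u)\<^sup>2"
      by (simp add: linear_scale[OF matrix_vector_mul_linear] power2_eq_square field_simps)
    finally show ?thesis
      using False by (simp add: inner_diff_right dot_square_norm field_simps)
  qed simp
  have "A *v x - l *\<^sub>R x = 0"
    by (rule symmetric_psd_kernel[of "\<lambda>u. A *v u - l *\<^sub>R u", OF _ _ psd])
       (auto intro!: linear_compose_sub linear_compose_scale_right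
         simp: sym inner_diff_left inner_diff_right l_def[symmetric] xx linear_id[unfolded id_def])
  then have "l \<in> eigenvalues A"
    using xx by (auto simp: eigenvalues_def intro!: exI[of _ x])
  then show ?thesis by blast
qed

lemma lambda_min_negative_direction:
  fixes A :: "real^'n^'n"
  assumes sym: "\<And>u v. (A *v u) \<bullet> v = u \<bullet> (A *v v)" and "lambda_min A < 0"
  obtains v where "v \<bullet> (A *v v) < 0"
proof -
  have "lambda_min A \<in> eigenvalues A"
    unfolding lambda_min_def
    using finite_eigenvalues_symmetric[OF sym] eigenvalues_symmetric_nonempty[OF sym] by (rule Min_in)
  then obtain v where "v \<noteq> 0" "A *v v = lambda_min A *\<^sub>R v"
    by (auto simp: eigenvalues_def)
  with \<open>lambda_min A < 0\<close> show thesis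
    by (intro that[of v]) (simp add: mult_neg_pos)
qed

section \<open>Null sets from chords on which a quadratic form is nonnegative\<close>

text \<open>A set on which a form with a negative direction \<open>v\<close> is nonnegative along all chords meets
  every line parallel to \<open>v\<close> at most once, and so does its closure. Hence the translates of the
  closure along \<open>v\<close> are disjoint, while infinitely many of them fit into a ball.\<close>

lemma negligible_if_chords_nonneg:
  fixes H :: "'a::euclidean_space \<Rightarrow> 'a"
  assumes lin: "linear H" and "bounded S"
    and nonneg: "\<And>x y. x \<in> S \<Longrightarrow> y \<in> S \<Longrightarrow> (x - y) \<bullet> H (x - y) \<ge> 0"
    and v: "v \<bullet> H v < 0"
  shows "negligible S"
proof -
  \<comment> \<open>Nothing is known about the measurability of \<open>S\<close>. Its closure is
    compact, hence measurable, and inherits the condition on chords because that condition is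
    closed.\<close>
  define C where "C = closure S"
  have "closed {z::'a \<times> 'a. 0 \<le> (fst z - snd z) \<bullet> H (fst z - snd z)}"
    by (intro closed_Collect_le continuous_intros linear_continuous_on_compose[OF _ lin])
  then have "closure (S \<times> S) \<subseteq> {z. 0 \<le> (fst z - snd z) \<bullet> H (fst z - snd z)}"
    using nonneg by (intro closure_minimal) auto
  then have C: "(x - y) \<bullet> H (x - y) \<ge> 0" if "x \<in> C" "y \<in> C" for x y
    using that unfolding closure_Times C_def by auto
  have "compact C"
    unfolding C_def using \<open>bounded S\<close> by simp
  then have Cm: "C \<in> lmeasurable"
    by (rule lmeasurable_compact)
  obtain R where R: "\<And>x. x \<in> C \<Longrightarrow> norm x \<le> R"
    using compact_imp_bounded[OF \<open>compact C\<close>] by (auto simp: bounded_iff)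
  \<comment> \<open>The factors are pairwise distinct, which gives disjointness, and at most 1,
    which keeps all translates in one ball.\<close>
  define T where "T n = (+) ((1 / real (Suc n)) *\<^sub>R v) ` C" for n
  have Tm: "T n \<in> lmeasurable" "measure lebesgue (T n) = measure lebesgue C" for n
    using Cm by (simp_all add: T_def measurable_translation measure_translation)
  have disj: "disjoint_family T"
    unfolding disjoint_family_on_def
  proof (intro ballI impI)
    fix m n :: nat assume "m \<noteq> n"
    show "T m \<inter> T n = {}"
    proof (rule ccontr)
      assume "T m \<inter> T n \<noteq> {}"
      then obtain x y where xy: "x \<in> C" "y \<in> C"
        "(1 / real (Suc m)) *\<^sub>R v + x = (1 / real (Suc n)) *\<^sub>R v + y"
        unfolding T_def by blast
      define s where "s = 1 / real (Suc n) - 1 / real (Suc m)"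
      have "s \<noteq> 0" using \<open>m \<noteq> n\<close> by (simp add: s_def)
      have "x - y = s *\<^sub>R v" using xy(3) by (simp add: s_def algebra_simps)
      then have "(x - y) \<bullet> H (x - y) = s\<^sup>2 * (v \<bullet> H v)"
        by (simp add: linear_scale[OF lin] power2_eq_square)
      also have "\<dots> < 0" using v \<open>s \<noteq> 0\<close> by (simp add: mult_pos_neg)
      finally show False using C[OF xy(1,2)] by simp
    qed
  qed
  have T_sub: "T n \<subseteq> cball 0 (norm v + R)" for n
  proof
    fix z assume "z \<in> T n"
    then obtain x where x: "x \<in> C" "z = (1 / real (Suc n)) *\<^sub>R v + x"
      unfolding T_def by blast
    have "norm z \<le> norm ((1 / real (Suc n)) *\<^sub>R v) + norm x"
      unfolding x(2) by (rule norm_triangle_ineq)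
    also have "\<dots> \<le> norm v + R"
      using R[OF x(1)] by (intro add_mono) (simp_all add: field_simps)
    finally show "z \<in> cball 0 (norm v + R)" by simp
  qed
  have le: "real N * measure lebesgue C \<le> measure lebesgue (cball (0::'a) (norm v + R))" for N
  proof -
    have "measure lebesgue (\<Union>n\<in>{..<N}. T n) = (\<Sum>n<N. measure lebesgue (T n))"
      using Tm(1) disj
      by (intro measure_finite_Union)
         (auto simp del: emeasure_completion simp: disjoint_family_on_def fmeasurableD2)
    also have "\<dots> = real N * measure lebesgue C" by (simp add: Tm(2))
    finally have "real N * measure lebesgue C = measure lebesgue (\<Union>n\<in>{..<N}. T n)" by simp
    also have "\<dots> \<le> measure lebesgue (cball (0::'a) (norm v + R))"
      using T_sub Tm(1) by (intro measure_mono_fmeasurable) (auto simp: fmeasurableD)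
    finally show ?thesis .
  qed
  have "measure lebesgue C = 0"
  proof (rule ccontr)
    assume "measure lebesgue C \<noteq> 0"
    then have "measure lebesgue C > 0" using measure_nonneg[of lebesgue C] by linarith
    then show False
      using reals_Archimedean3 le by (meson not_less)
  qed
  then have "negligible C"
    using Cm by (simp add: negligible_iff_measure)
  then show ?thesis
    unfolding C_def by (rule negligible_subset) (rule closure_subset)
qed

section \<open>Growth of the quadratic form along differences of trajectories\<close>

text \<open>Here \<open>w k\<close> stands for a difference of gradients. The error
  \<open>m / 2\<close> leaves at least half of the first-order gain of
  \<open>- (d k \<bullet> H (d k))\<close>, and the bound on \<open>a k\<close> lets the
  second-order term consume at most half of what is left. A negative initial value would then force
  growth proportional to the partial sums of \<open>a\<close>, against the bound
  \<open>R\<close>.\<close>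

lemma backward_ascent_form_nonneg:
  fixes H :: "'a::real_inner \<Rightarrow> 'a" and d w :: "nat \<Rightarrow> 'a" and a :: "nat \<Rightarrow> real"
  assumes lin: "linear H" and sym: "\<And>u v. H u \<bullet> v = u \<bullet> H v"
    and m: "m > 0" "m \<le> M" "\<And>x. m * norm x \<le> norm (H x)" "\<And>x. norm (H x) \<le> M * norm x"
    and a: "\<And>k. a k > 0" "\<And>k. a k \<le> m\<^sup>2 / (8 * M ^ 3)" "\<not> summable a"
    and d: "\<And>k. d k = d (Suc k) + a k *\<^sub>R w k" "\<And>k. norm (d k) \<le> R"
    and w: "\<And>k. norm (w k - H (d (Suc k))) \<le> m / 2 * norm (d (Suc k))"
  shows "d 0 \<bullet> H (d 0) \<ge> 0"
proof (rule ccontr)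
  assume neg: "\<not> d 0 \<bullet> H (d 0) \<ge> 0"
  define q where "q k = - (d k \<bullet> H (d k))" for k
  have M: "M > 0" using m by linarith
  have step: "q k + a k * m\<^sup>2 / 2 * (norm (d (Suc k)))\<^sup>2 \<le> q (Suc k)" for k
  proof -
    define x where "x = d (Suc k)"
    define n where "n = norm x"
    define e where "e = w k - H x"
    have e: "norm e \<le> m / 2 * n" using w[of k] by (simp add: e_def x_def n_def)
    have wk: "w k = H x + e" by (simp add: e_def)
    have Hx: "m * n \<le> norm (H x)" "norm (H x) \<le> M * n" using m by (simp_all add: n_def)
    have n: "n \<ge> 0" by (simp add: n_def)
    have "\<bar>e \<bullet> H x\<bar> \<le> m / 2 * n * norm (H x)"
      using Cauchy_Schwarz_ineq2[of e "H x"] mult_right_mono[OF e norm_ge_zero[of "H x"]] by linarith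
    then have "w k \<bullet> H x \<ge> norm (H x) * (norm (H x) - m / 2 * n)"
      unfolding wk by (simp add: inner_add_left dot_square_norm power2_eq_square algebra_simps)
    \<comment> \<open>Both factors are bounded below: \<open>norm (H x)\<close> by
      \<open>m * n\<close>, hence the second one by \<open>m / 2 * n\<close>.\<close>
    moreover have "norm (H x) * (norm (H x) - m / 2 * n) \<ge> (m * n) * (m / 2 * n)"
      using Hx m n by (intro mult_mono) (auto simp: mult_nonneg_nonneg)
    ultimately have first: "w k \<bullet> H x \<ge> m\<^sup>2 / 2 * n\<^sup>2"
      by (simp add: power2_eq_square algebra_simps)
    have "norm (w k) \<le> norm (H x) + norm e" unfolding wk by (rule norm_triangle_ineq)
    also have "\<dots> \<le> M * n + M * n"
      using Hx e mult_right_mono[of "m / 2" M n] m n by (intro add_mono) auto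
    finally have nw: "norm (w k) \<le> 2 * M * n" by simp
    have "- (w k \<bullet> H (w k)) \<le> norm (w k) * norm (H (w k))"
      using Cauchy_Schwarz_ineq2[of "w k" "H (w k)"] by linarith
    also have "\<dots> \<le> norm (w k) * (M * norm (w k))"
      using m by (intro mult_left_mono) auto
    also have "\<dots> = M * (norm (w k))\<^sup>2" by (simp add: power2_eq_square)
    finally have "- (w k \<bullet> H (w k)) \<le> M * (norm (w k))\<^sup>2" .
    also have "\<dots> \<le> M * (2 * M * n)\<^sup>2"
      using nw M by (intro mult_left_mono power_mono) auto
    finally have second: "- (w k \<bullet> H (w k)) \<le> 4 * M ^ 3 * n\<^sup>2"
      by (simp add: power2_eq_square power3_eq_cube algebra_simps)
    \<comment> \<open>The threshold \<open>m\<^sup>2 / (8 * M ^ 3)\<close> is chosen for this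
      inequality, which absorbs the quadratic term in \<open>a k\<close>.\<close>
    have "a k * (4 * M ^ 3) \<le> m\<^sup>2 / 2"
      using a(2)[of k] M by (simp add: field_simps)
    then have "a k * (a k * (4 * M ^ 3) * n\<^sup>2) \<le> a k * (m\<^sup>2 / 2 * n\<^sup>2)"
      using a(1)[of k] by (intro mult_left_mono mult_right_mono) auto
    moreover have "(a k)\<^sup>2 * - (w k \<bullet> H (w k)) \<le> (a k)\<^sup>2 * (4 * M ^ 3 * n\<^sup>2)"
      using second by (intro mult_left_mono) auto
    moreover have "(2 * a k) * (w k \<bullet> H x) \<ge> (2 * a k) * (m\<^sup>2 / 2 * n\<^sup>2)"
      using first a(1)[of k] by (intro mult_left_mono) auto
    moreover have "q k = q (Suc k) - (2 * a k) * (w k \<bullet> H x) + (a k)\<^sup>2 * - (w k \<bullet> H (w k))"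
      unfolding q_def d(1)[of k] x_def[symmetric] using sym[of x "w k"]
      by (simp add: linear_add[OF lin] linear_scale[OF lin] inner_add_left inner_add_right
          power2_eq_square algebra_simps inner_commute)
    ultimately show ?thesis
      unfolding x_def[symmetric] n_def[symmetric] by (simp add: power2_eq_square algebra_simps)
  qed
  have q_le: "q k \<le> M * (norm (d k))\<^sup>2" for k
  proof -
    have "q k \<le> norm (d k) * norm (H (d k))"
      unfolding q_def using Cauchy_Schwarz_ineq2[of "d k" "H (d k)"] by linarith
    also have "\<dots> \<le> norm (d k) * (M * norm (d k))"
      using m by (intro mult_left_mono) auto
    finally show ?thesis by (simp add: power2_eq_square algebra_simps)
  qed
  have mono: "q k \<le> q (Suc k)" for k
    using step[of k] a(1)[of k] zero_le_power2[of "norm (d (Suc k))"] zero_le_power2[of m]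
    by (smt (verit) divide_nonneg_pos mult_nonneg_nonneg)
  have q0: "q 0 \<le> q k" for k
    using lift_Suc_mono_le[of q, OF mono] by simp
  \<comment> \<open>Since \<open>q 0 \<le> q (Suc k) \<le> M * (norm (d (Suc k)))\<^sup>2\<close>,
    the differences stay away from zero, and \<open>step\<close> turns this into a gain of at least
    \<open>a k * c\<close>.\<close>
  define c where "c = m\<^sup>2 / (2 * M) * q 0"
  have "q 0 > 0" using neg by (simp add: q_def)
  then have c: "c > 0" using m M by (simp add: c_def)
  have "a k * c \<le> q (Suc k) - q k" for k
  proof -
    have "q 0 / M \<le> (norm (d (Suc k)))\<^sup>2"
      using q_le[of "Suc k"] q0[of "Suc k"] M by (simp add: field_simps)
    then have "a k * m\<^sup>2 / 2 * (q 0 / M) \<le> a k * m\<^sup>2 / 2 * (norm (d (Suc k)))\<^sup>2"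
      using a(1)[of k] by (intro mult_left_mono) auto
    then show ?thesis using step[of k] by (simp add: c_def)
  qed
  then have "(\<Sum>k<N. a k * c) \<le> (\<Sum>k<N. q (Suc k) - q k)" for N
    by (rule sum_mono)
  then have "(\<Sum>k<N. a k) * c \<le> q N - q 0" for N
    by (simp add: sum_lessThan_telescope sum_distrib_right)
  moreover have "q N \<le> M * R\<^sup>2" for N
    using q_le[of N] d(2)[of N] M by (smt (verit) mult_left_mono norm_ge_zero power_mono)
  ultimately have "(\<Sum>k<N. a k) * c \<le> M * R\<^sup>2" for N
    using \<open>q 0 > 0\<close> by (smt (verit))
  then have "(\<Sum>k<N. a k) \<le> M * R\<^sup>2 / c" for N
    using c by (simp add: field_simps)
  then have "summable a"
    using a(1) by (intro summableI_nonneg_bounded[of a "M * R\<^sup>2 / c"]) (auto intro: less_imp_le)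
  with a(3) show False by contradiction
qed

section \<open>Gradients, proximal steps and step sizes\<close>

text \<open>The adjoint of the derivative, evaluated at 1, is its Riesz representative; uniqueness
  then settles the \<open>THE\<close> in \<open>gradient\<close>.\<close>

lemma GDERIV_gradient:
  assumes "f differentiable at x"
  shows "GDERIV f x :> gradient f x"
proof -
  obtain f' where f': "(f has_derivative f') (at x)"
    using assms by (auto simp: differentiable_def)
  have "f' h = h \<bullet> adjoint f' 1" for h
    using adjoint_works[OF has_derivative_linear[OF f'], of h 1] by simp
  then have "f' = (\<lambda>h. h \<bullet> adjoint f' 1)" by (rule ext)
  with f' have D: "GDERIV f x :> adjoint f' 1"
    unfolding gderiv_def by (rule has_derivative_eq_rhs)
  have unique: "D = E" if "GDERIV f x :> D" "GDERIV f x :> E" for D E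
    using has_derivative_unique[OF that[unfolded gderiv_def]] by (metis vector_eq_ldot)
  have "gradient f x = adjoint f' 1"
    unfolding gradient_def by (rule the_equality) (auto intro: D unique)
  with D show ?thesis by simp
qed

text \<open>First-order condition at the minimizer. It expresses the old point explicitly through
  the new one, so the proximal map itself is never differentiated.\<close>

lemma prox_map_stationary:
  assumes f: "\<And>x. f differentiable at x" and "\<alpha> k > 0" and "prox_well_defined f \<alpha>"
  shows "x = prox_map f \<alpha> k x + \<alpha> k *\<^sub>R gradient f (prox_map f \<alpha> k x)"
proof -
  define z where "z = prox_map f \<alpha> k x"
  have "\<exists>z. is_arg_min (prox_objective f (\<alpha> k) x) (\<lambda>_. True) z"
    using \<open>prox_well_defined f \<alpha>\<close> unfolding prox_well_defined_def by blast
  then have "is_arg_min (prox_objective f (\<alpha> k) x) (\<lambda>_. True) z"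
    unfolding z_def prox_map_def arg_min_def by (rule someI_ex)
  then have min: "prox_objective f (\<alpha> k) x z \<le> prox_objective f (\<alpha> k) x y" for y
    by (auto simp: is_arg_min_linorder)
  let ?D = "\<lambda>h. h \<bullet> gradient f z + 1 / (2 * \<alpha> k) * ((x - z) \<bullet> (- h) + (- h) \<bullet> (x - z))"
  have "((\<lambda>z. f z + 1 / (2 * \<alpha> k) * ((x - z) \<bullet> (x - z))) has_derivative ?D) (at z)"
    by (intro has_derivative_add has_derivative_mult_right has_derivative_inner
        GDERIV_gradient[OF f, unfolded gderiv_def]) (auto intro!: derivative_eq_intros)
  then have "(prox_objective f (\<alpha> k) x has_derivative ?D) (at z)"
    by (simp add: prox_objective_def[abs_def] dot_square_norm)
  then have "?D = (\<lambda>h. 0)"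
    by (rule differential_zero_maxmin[of z UNIV, rotated 2]) (use min in auto)
  then have "?D h = 0" for h by (rule fun_cong)
  moreover have "h \<bullet> (gradient f z - (1 / \<alpha> k) *\<^sub>R (x - z)) = ?D h" for h
    using \<open>\<alpha> k > 0\<close> by (simp add: inner_diff_right inner_diff_left inner_add_right inner_commute field_simps)
  ultimately have "h \<bullet> (gradient f z - (1 / \<alpha> k) *\<^sub>R (x - z)) = 0" for h
    by simp
  then have "gradient f z - (1 / \<alpha> k) *\<^sub>R (x - z) = 0"
    by (metis inner_eq_zero_iff)
  then show ?thesis
    using \<open>\<alpha> k > 0\<close> by (simp add: z_def[symmetric])
qed

lemma not_summable_of_bigomega_harmonic:
  fixes \<alpha> :: "nat \<Rightarrow> real"
  assumes "\<And>k. \<alpha> k \<ge> 0" and "\<alpha> \<in> \<Omega>(\<lambda>k. 1 / real k)"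
  shows "\<not> summable \<alpha>"
proof
  assume "summable \<alpha>"
  have "(\<lambda>k. 1 / real k) \<in> O(\<alpha>)"
    using assms(2) by (simp add: bigomega_iff_bigo)
  \<comment> \<open>The term at \<open>k = 0\<close> is \<open>1 / 0 = 0\<close>, so this is the
    harmonic series with a zero in front.\<close>
  then have "summable (\<lambda>k. 1 / real k)"
    by (rule summable_comparison_test_bigo[rotated]) (use \<open>summable \<alpha>\<close> assms(1) in simp)
  then show False
    using not_summable_harmonic[where 'a = real] by (simp add: field_simps)
qed

section \<open>The Hessian and the local linearization of the gradient\<close>

text \<open>Continuity of the Hessian is measured in the norm of \<open>real^'n^'n\<close>, the mean
  value inequality in the operator norm. This crude comparison links the two.\<close>

lemma onorm_matrix_le:
  fixes A :: "real^'n^'n"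
  shows "onorm ((*v) A) \<le> real CARD('n) * real CARD('n) * norm A"
  by (rule onorm_le_matrix_component)
     (rule order_trans[OF component_le_norm_cart Finite_Cartesian_Product.norm_nth_le])

lemma has_derivative_gradient:
  assumes "C2 f"
  shows "(gradient f has_derivative (*v) (hessian f x)) (at x)"
  unfolding hessian_def
  by (rule jacobian_works[THEN iffD1]) (use assms in \<open>simp add: C2_def\<close>)

lemma hessian_symmetric:
  assumes "C2 f"
  shows "(hessian f x *v u) \<bullet> v = u \<bullet> (hessian f x *v v)"
proof (rule symmetric_second_derivative[where g = "gradient f"])
  show "GDERIV f y :> gradient f y" for y
    using assms by (intro GDERIV_gradient) (simp add: C2_def)
  show "(gradient f has_derivative (*v) (hessian f y)) (at y)" for y
    using assms by (rule has_derivative_gradient)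
  show "isCont (\<lambda>y. hessian f y *v u) x" for u
  proof -
    have "linear (\<lambda>A::real^'a^'a. A *v u)"
      by (rule linearI) (simp_all add: matrix_vector_mult_add_rdistrib scaleR_matrix_vector_assoc)
    moreover have "isCont (hessian f) x"
      using assms by (simp add: C2_def continuous_on_eq_continuous_at)
    ultimately show ?thesis
      by (rule bounded_linear.isCont[OF linear_conv_bounded_linear[THEN iffD1]])
  qed
qed

text \<open>Strict differentiability of the gradient at \<open>p\<close>: the mean value inequality
  for \<open>gradient f\<close> minus its linearization, whose derivative is small near
  \<open>p\<close>. Both points vary, as the comparison of two trajectories demands.\<close>

lemma gradient_near_linear:
  assumes "C2 f" and "\<epsilon> > 0"
  obtains r where "r > 0"
    "\<And>x y. x \<in> ball p r \<Longrightarrow> y \<in> ball p r \<Longrightarrow>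
      norm (gradient f x - gradient f y - hessian f p *v (x - y)) \<le> \<epsilon> * norm (x - y)"
proof -
  let ?c = "real CARD('a) * real CARD('a)"
  have pos: "\<epsilon> / ?c > 0" using \<open>\<epsilon> > 0\<close> by simp
  have "isCont (hessian f) p"
    using assms by (simp add: C2_def continuous_on_eq_continuous_at)
  note this[unfolded continuous_at_eps_delta, rule_format, OF pos]
  then obtain r where r: "r > 0" "\<And>y. dist y p < r \<Longrightarrow> dist (hessian f y) (hessian f p) < \<epsilon> / ?c"
    by (elim exE conjE) auto
  have "norm ((gradient f x - hessian f p *v x) - (gradient f y - hessian f p *v y)) \<le> \<epsilon> * norm (x - y)"
    if "x \<in> ball p r" "y \<in> ball p r" for x y
  proof (rule differentiable_bound[OF convex_ball _ _ that])
    fix z assume z: "z \<in> ball p r"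
    have "((\<lambda>x. gradient f x - hessian f p *v x) has_derivative
        (\<lambda>h. hessian f z *v h - hessian f p *v h)) (at z within ball p r)"
      by (rule has_derivative_diff[OF has_derivative_at_withinI[OF has_derivative_gradient[OF \<open>C2 f\<close>]]
            bounded_linear_imp_has_derivative[OF matrix_vector_mul_bounded_linear]])
    then show "((\<lambda>x. gradient f x - hessian f p *v x) has_derivative (*v) (hessian f z - hessian f p))
        (at z within ball p r)"
      by (simp add: matrix_vector_mult_diff_rdistrib[abs_def])
    have "onorm ((*v) (hessian f z - hessian f p)) \<le> ?c * norm (hessian f z - hessian f p)"
      by (rule onorm_matrix_le)
    also have "\<dots> \<le> ?c * (\<epsilon> / ?c)"
      using r(2)[of z] z by (intro mult_left_mono) (auto simp: dist_norm norm_minus_commute)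
    finally show "onorm ((*v) (hessian f z - hessian f p)) \<le> \<epsilon>" by simp
  qed
  then show thesis
    by (intro that[OF r(1)]) (simp add: matrix_vector_mult_diff_distrib algebra_simps)
qed

section \<open>Trajectories that stay near one saddle\<close>

text \<open>The radius \<open>r\<close> controls the linearization error and \<open>K0\<close> the
  step sizes, so one \<open>r\<close> serves all \<open>K \<ge> K0\<close>. The sequences
  \<open>s\<close> are arbitrary solutions of the backward recursion, and the proximal map does not
  occur.\<close>

lemma negligible_trajectories_near_saddle:
  fixes f :: "real^'n \<Rightarrow> real"
  assumes "C2 f" and p: "p \<in> strict_saddles f" and inv: "invertible (hessian f p)"
    and \<alpha>: "\<And>k. \<alpha> k > 0" "\<not> summable \<alpha>" "\<alpha> \<longlonglongrightarrow> 0"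
  obtains r K0 where "r > 0"
    "\<And>K. K \<ge> K0 \<Longrightarrow> negligible {s 0 |s. \<forall>k. s k \<in> ball p r \<and>
        s k = s (Suc k) + \<alpha> (k + K) *\<^sub>R gradient f (s (Suc k))}"
proof -
  let ?H = "(*v) (hessian f p)"
  have sym: "?H u \<bullet> v = u \<bullet> ?H v" for u v
    using \<open>C2 f\<close> by (rule hessian_symmetric)
  obtain v where v: "v \<bullet> ?H v < 0"
    using lambda_min_negative_direction[OF sym] p by (auto simp: strict_saddles_def)
  have "inj ?H" using inv by (rule inj_matrix_vector_mult)
  then obtain m where m: "m > 0" "\<And>x. m * norm x \<le> norm (?H x)"
    using linear_inj_bounded_below_pos[OF matrix_vector_mul_linear] by metis
  \<comment> \<open>The maximum gives \<open>m \<le> M\<close> at once, and with it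
    \<open>M > 0\<close>.\<close>
  define M where "M = max m (onorm ?H)"
  have M: "m \<le> M" "norm (?H x) \<le> M * norm x" for x
    using onorm[OF matrix_vector_mul_bounded_linear, of "hessian f p" x]
      mult_right_mono[of "onorm ?H" M "norm x"] by (auto simp: M_def)
  obtain r where r: "r > 0" "\<And>x y. x \<in> ball p r \<Longrightarrow> y \<in> ball p r \<Longrightarrow>
      norm (gradient f x - gradient f y - ?H (x - y)) \<le> m / 2 * norm (x - y)"
    using gradient_near_linear[OF \<open>C2 f\<close>, of "m / 2" p] m(1) by auto
  have "0 < m\<^sup>2 / (8 * M ^ 3)" using m(1) M(1) by simp
  then have "\<forall>\<^sub>F k in sequentially. \<alpha> k < m\<^sup>2 / (8 * M ^ 3)"
    using \<alpha>(3) by (intro order_tendstoD)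
  then obtain K0 where K0: "\<And>k. k \<ge> K0 \<Longrightarrow> \<alpha> k \<le> m\<^sup>2 / (8 * M ^ 3)"
    unfolding eventually_sequentially by (meson less_imp_le)
  have "negligible {s 0 |s. \<forall>k. s k \<in> ball p r \<and>
        s k = s (Suc k) + \<alpha> (k + K) *\<^sub>R gradient f (s (Suc k))}" if "K \<ge> K0" for K
  proof (rule negligible_if_chords_nonneg[OF matrix_vector_mul_linear _ _ v])
    show "bounded {s 0 |s. \<forall>k. s k \<in> ball p r \<and>
        s k = s (Suc k) + \<alpha> (k + K) *\<^sub>R gradient f (s (Suc k))}"
      by (rule bounded_subset[OF bounded_ball[of p r]]) blast
  next
    fix x y
    assume "x \<in> {s 0 |s. \<forall>k. s k \<in> ball p r \<and>
        s k = s (Suc k) + \<alpha> (k + K) *\<^sub>R gradient f (s (Suc k))}"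
    then obtain s where s: "x = s 0" "\<And>k. s k \<in> ball p r"
      "\<And>k. s k = s (Suc k) + \<alpha> (k + K) *\<^sub>R gradient f (s (Suc k))" by blast
    assume "y \<in> {s 0 |s. \<forall>k. s k \<in> ball p r \<and>
        s k = s (Suc k) + \<alpha> (k + K) *\<^sub>R gradient f (s (Suc k))}"
    then obtain t where t: "y = t 0" "\<And>k. t k \<in> ball p r"
      "\<And>k. t k = t (Suc k) + \<alpha> (k + K) *\<^sub>R gradient f (t (Suc k))" by blast
    define d where "d k = s k - t k" for k
    define w where "w k = gradient f (s (Suc k)) - gradient f (t (Suc k))" for k
    have "0 \<le> d 0 \<bullet> ?H (d 0)"
    proof (rule backward_ascent_form_nonneg[OF matrix_vector_mul_linear sym m(1) M(1) m(2) M(2)])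
      show "\<alpha> (k + K) > 0" for k by (rule \<alpha>(1))
      show "\<alpha> (k + K) \<le> m\<^sup>2 / (8 * M ^ 3)" for k using K0 that by simp
      show "\<not> summable (\<lambda>k. \<alpha> (k + K))" using \<alpha>(2) by (simp add: summable_iff_shift)
      show "d k = d (Suc k) + \<alpha> (k + K) *\<^sub>R w k" for k
        unfolding d_def w_def by (subst s(3), subst t(3)) (simp add: algebra_simps)
      show "norm (d k) \<le> 2 * r" for k
        using s(2)[of k] t(2)[of k] dist_triangle_half_r[of p "s k" "2 * r" "t k"]
        by (simp add: d_def dist_norm[symmetric])
      show "norm (w k - ?H (d (Suc k))) \<le> m / 2 * norm (d (Suc k))" for k
        unfolding w_def d_def by (rule r(2)[OF s(2) t(2)])
    qed
    then show "(x - y) \<bullet> ?H (x - y) \<ge> 0"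
      by (simp add: d_def s(1) t(1))
  qed
  with r(1) show thesis by (rule that)
qed

section \<open>Return to the starting points\<close>

text \<open>The composition of the backward maps with indices \<open>0\<close> to
  \<open>k - 1\<close>, the one with the largest index applied first. It recovers a starting point
  from its iterate number \<open>k\<close>.\<close>

primrec prox_inverse :: "(real^'n \<Rightarrow> real) \<Rightarrow> (nat \<Rightarrow> real) \<Rightarrow> nat \<Rightarrow> real^'n \<Rightarrow> real^'n" where
  "prox_inverse f \<alpha> 0 y = y"
| "prox_inverse f \<alpha> (Suc k) y = prox_inverse f \<alpha> k (y + \<alpha> k *\<^sub>R gradient f y)"

lemma prox_seq_step:
  assumes "\<And>x. f differentiable at x" and "\<And>k. \<alpha> k > 0" and "prox_well_defined f \<alpha>"
  shows "prox_seq f \<alpha> x k = prox_seq f \<alpha> x (Suc k) + \<alpha> k *\<^sub>R gradient f (prox_seq f \<alpha> x (Suc k))"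
  unfolding prox_seq.simps(2) by (rule prox_map_stationary[OF assms])

lemma prox_inverse_prox_seq:
  assumes "\<And>x. f differentiable at x" and "\<And>k. \<alpha> k > 0" and "prox_well_defined f \<alpha>"
  shows "prox_inverse f \<alpha> k (prox_seq f \<alpha> x k) = x"
proof (induction k)
  case (Suc k)
  then show ?case
    by (simp only: prox_inverse.simps prox_seq_step[OF assms, symmetric])
qed simp

text \<open>Differentiable maps of a Euclidean space into itself send null sets to null sets; this
  carries negligibility back to time 0.\<close>

lemma prox_inverse_differentiable:
  assumes "C2 f"
  shows "prox_inverse f \<alpha> k differentiable at y"
proof (induction k arbitrary: y)
  case 0
  have "prox_inverse f \<alpha> 0 = (\<lambda>y. y)" by (simp add: fun_eq_iff)
  then show ?case by simp
next
  case (Suc k)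
  have "(\<lambda>y. y + \<alpha> k *\<^sub>R gradient f y) differentiable at y"
    using assms by (intro derivative_intros) (simp_all add: C2_def)
  then have "prox_inverse f \<alpha> k \<circ> (\<lambda>y. y + \<alpha> k *\<^sub>R gradient f y) differentiable at y"
    by (rule differentiable_chain_at) (rule Suc.IH)
  moreover have "prox_inverse f \<alpha> (Suc k) = prox_inverse f \<alpha> k \<circ> (\<lambda>y. y + \<alpha> k *\<^sub>R gradient f y)"
    by (simp add: fun_eq_iff)
  ultimately show ?case by (simp only:)
qed

section \<open>Countable cover of the stable set\<close>

theorem theorem5p4:
  fixes f :: "real^'n \<Rightarrow> real" and \<alpha> :: "nat \<Rightarrow> real"
  assumes "C2 f"
    and "\<And>x. x \<in> strict_saddles f \<Longrightarrow> invertible (hessian f x)"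
    and "\<And>k. \<alpha> k > 0"
    and "\<alpha> \<in> \<Omega>(\<lambda>k. 1 / real k)"
    and "\<alpha> \<longlonglongrightarrow> 0"
    and "prox_well_defined f \<alpha>"
  shows "stable_set f \<alpha> (strict_saddles f) \<in> null_sets lebesgue"
proof -
  note step = prox_seq_step[of f \<alpha>, OF _ assms(3,6)]
    and inverse = prox_inverse_prox_seq[of f \<alpha>, OF _ assms(3,6)]
  have diff: "f differentiable at x" for x using \<open>C2 f\<close> by (simp add: C2_def)
  have div: "\<not> summable \<alpha>"
    using assms(3,4) by (intro not_summable_of_bigomega_harmonic) (auto intro: less_imp_le)
  \<comment> \<open>The possible positions at time \<open>K\<close> of backward trajectories that
    remain in \<open>U\<close> from then on; hence the shift of \<alpha> by
    \<open>K\<close>.\<close>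
  define Z where "Z U K = {s 0 |s. \<forall>k. s k \<in> U \<and>
      s k = s (Suc k) + \<alpha> (k + K) *\<^sub>R gradient f (s (Suc k))}" for U K
  define \<U> where "\<U> = {U. open U \<and> (\<exists>K0. \<forall>K\<ge>K0. negligible (Z U K))}"
  obtain \<V> where \<V>: "\<V> \<subseteq> \<U>" "countable \<V>" "\<Union>\<V> = \<Union>\<U>"
    by (rule Lindelof[of \<U>]) (auto simp: \<U>_def)
  have cover: "\<exists>V\<in>\<V>. p \<in> V" if p: "p \<in> strict_saddles f" for p
  proof -
    obtain r K0 where "r > 0" "\<And>K. K \<ge> K0 \<Longrightarrow> negligible (Z (ball p r) K)"
      unfolding Z_def
      using negligible_trajectories_near_saddle[OF \<open>C2 f\<close> p assms(2)[OF p] assms(3) div assms(5)]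
      by blast
    then have "ball p r \<in> \<U>" "p \<in> ball p r" by (auto simp: \<U>_def)
    then show ?thesis using \<V>(3) by blast
  qed
  have "\<exists>K0. \<forall>K\<ge>K0. negligible (Z V K)" if "V \<in> \<V>" for V
    using \<V>(1) that by (auto simp: \<U>_def)
  then obtain K0 where K0: "\<And>V K. V \<in> \<V> \<Longrightarrow> K \<ge> K0 V \<Longrightarrow> negligible (Z V K)"
    by metis
  \<comment> \<open>The time from which a trajectory stays in \<open>V\<close> depends on its
    starting point, so all late times \<open>K\<close> are collected; there are countably
    many.\<close>
  define N where "N V = (\<Union>K\<in>{K0 V..}. prox_inverse f \<alpha> K ` Z V K)" for V
  have "stable_set f \<alpha> (strict_saddles f) \<subseteq> (\<Union>V\<in>\<V>. N V)"
  proof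
    fix x assume "x \<in> stable_set f \<alpha> (strict_saddles f)"
    then obtain p where p: "p \<in> strict_saddles f" "prox_seq f \<alpha> x \<longlonglongrightarrow> p"
      by (auto simp: stable_set_def)
    obtain V where V: "V \<in> \<V>" "p \<in> V" using cover[OF p(1)] by blast
    then have "open V" using \<V>(1) by (auto simp: \<U>_def)
    then obtain L where L: "\<And>k. k \<ge> L \<Longrightarrow> prox_seq f \<alpha> x k \<in> V"
      using topological_tendstoD[OF p(2) _ V(2)] by (auto simp: eventually_sequentially)
    \<comment> \<open>Late enough for the iterates to stay in \<open>V\<close> and for
      \<open>Z V K\<close> to be negligible.\<close>
    define K where "K = max L (K0 V)"
    have "prox_seq f \<alpha> x (0 + K) \<in> Z V K"
      unfolding Z_def
    proof (intro CollectI exI[of _ "\<lambda>k. prox_seq f \<alpha> x (k + K)"] conjI allI)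
      show "prox_seq f \<alpha> x (k + K) \<in> V" for k by (rule L) (simp add: K_def)
      show "prox_seq f \<alpha> x (k + K) = prox_seq f \<alpha> x (Suc k + K)
          + \<alpha> (k + K) *\<^sub>R gradient f (prox_seq f \<alpha> x (Suc k + K))" for k
        using step[OF diff, of x "k + K"] by (simp only: add_Suc)
    qed (rule refl)
    then have "x \<in> prox_inverse f \<alpha> K ` Z V K"
      using inverse[OF diff, of K x] by (metis add_0 image_eqI)
    then have "x \<in> N V"
      unfolding N_def by (rule UN_I[rotated]) (simp add: K_def)
    then show "x \<in> (\<Union>V\<in>\<V>. N V)"
      by (rule UN_I[OF V(1)])
  qed
  moreover have "negligible (\<Union>V\<in>\<V>. N V)"
  proof -
    have "negligible (prox_inverse f \<alpha> K ` Z V K)" if "V \<in> \<V>" "K \<ge> K0 V" for V K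
      using K0[OF that] prox_inverse_differentiable[OF \<open>C2 f\<close>]
      by (intro negligible_differentiable_image_negligible)
         (auto simp: differentiable_on_def intro: differentiable_at_withinI)
    then have "negligible (N V)" if "V \<in> \<V>" for V
      unfolding N_def using that by (intro negligible_countable_Union countable_image countableI_type) auto
    then show ?thesis
      using \<V>(2) by (intro negligible_countable_Union countable_image) auto
  qed
  ultimately show ?thesis
    using negligible_subset negligible_iff_null_sets by blast
qed

end
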